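(* Let $S(X)$ be the free Steiner loop with a finite set $X$ of free generators. If $|X|>3$, then the automorphism group $\mathrm{Aut}(S(X))$ is not finitely generated.
   Context: A Steiner loop is a commutative loop with identity $e$ satisfying $x\cdot x=e$ and $x\cdot(x\cdot y)=y$ for all $x,y$ (equivalently, a diassociative loop of exponent $2$). Steiner loops form a variety, and free objects are taken in this variety. *)

theory Defs
  imports "HOL-Algebra.Bij" "HOL-Algebra.Generated_Groups"
begin

section \<open>Steiner loops\<close>

locale loop =
  fixes L (structure)
  assumes m_closed [simp, intro]:
      "\<lbrakk>x \<in> carrier L; y \<in> carrier L\<rbrakk> \<Longrightarrow> x \<otimes> y \<in> carrier L"
    and one_closed [simp, intro]: "\<one> \<in> carrier L"
    and l_one [simp]: "x \<in> carrier L \<Longrightarrow> \<one> \<otimes> x = x"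
    and r_one [simp]: "x \<in> carrier L \<Longrightarrow> x \<otimes> \<one> = x"
    and left_division:
      "\<lbrakk>a \<in> carrier L; b \<in> carrier L\<rbrakk> \<Longrightarrow> \<exists>!x. x \<in> carrier L \<and> a \<otimes> x = b"
    and right_division:
      "\<lbrakk>a \<in> carrier L; b \<in> carrier L\<rbrakk> \<Longrightarrow> \<exists>!y. y \<in> carrier L \<and> y \<otimes> a = b"

locale steiner_loop = loop +
  assumes m_comm: "\<lbrakk>x \<in> carrier L; y \<in> carrier L\<rbrakk> \<Longrightarrow> x \<otimes> y = y \<otimes> x"
    and square: "x \<in> carrier L \<Longrightarrow> x \<otimes> x = \<one>"
    and left_inverse: "\<lbrakk>x \<in> carrier L; y \<in> carrier L\<rbrakk> \<Longrightarrow> x \<otimes> (x \<otimes> y) = y"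

section \<open>The free Steiner loop\<close>

text \<open>
  The free object is the term algebra over \<open>X\<close> modulo the fully invariant congruence generated
  by the identities of the variety.  The signature consists of the unit and the product only,
  since in a Steiner loop both divisions coincide with the product.
\<close>

datatype 'a loop_term = Unit | Gen 'a | Prod "'a loop_term" "'a loop_term"

definition terms_over :: "'a set \<Rightarrow> 'a loop_term set" where
  "terms_over X = {t. set_loop_term t \<subseteq> X}"

inductive_set steiner_cong :: "'a set \<Rightarrow> ('a loop_term \<times> 'a loop_term) set"
  for X :: "'a set" where
  refl: "t \<in> terms_over X \<Longrightarrow> (t, t) \<in> steiner_cong X"
| sym: "(s, t) \<in> steiner_cong X \<Longrightarrow> (t, s) \<in> steiner_cong X"
| trans: "(s, t) \<in> steiner_cong X \<Longrightarrow> (t, u) \<in> steiner_cong X \<Longrightarrow> (s, u) \<in> steiner_cong X"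
| prod: "(s, s') \<in> steiner_cong X \<Longrightarrow> (t, t') \<in> steiner_cong X \<Longrightarrow>
    (Prod s t, Prod s' t') \<in> steiner_cong X"
| unit: "t \<in> terms_over X \<Longrightarrow> (Prod Unit t, t) \<in> steiner_cong X"
| comm: "s \<in> terms_over X \<Longrightarrow> t \<in> terms_over X \<Longrightarrow> (Prod s t, Prod t s) \<in> steiner_cong X"
| square: "t \<in> terms_over X \<Longrightarrow> (Prod t t, Unit) \<in> steiner_cong X"
| left_inverse: "s \<in> terms_over X \<Longrightarrow> t \<in> terms_over X \<Longrightarrow>
    (Prod s (Prod s t), t) \<in> steiner_cong X"

definition free_steiner_loop :: "'a set \<Rightarrow> 'a loop_term set monoid" where
  "free_steiner_loop X =
    \<lparr>carrier = terms_over X // steiner_cong X,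
     mult = (\<lambda>A B. \<Union>s\<in>A. \<Union>t\<in>B. steiner_cong X `` {Prod s t}),
     one = steiner_cong X `` {Unit}\<rparr>"

definition free_gen :: "'a set \<Rightarrow> 'a \<Rightarrow> 'a loop_term set" where
  "free_gen X x = steiner_cong X `` {Gen x}"

section \<open>Finite generation\<close>

definition finitely_generated_group :: "('a, 'b) monoid_scheme \<Rightarrow> bool" where
  "finitely_generated_group G \<longleftrightarrow>
    (\<exists>A. finite A \<and> A \<subseteq> carrier G \<and> generate G A = carrier G)"

section \<open>The construction is the free object\<close>

lemma terms_over_simps [simp]:
  "Unit \<in> terms_over X"
  "Gen x \<in> terms_over X \<longleftrightarrow> x \<in> X"
  "Prod s t \<in> terms_over X \<longleftrightarrow> s \<in> terms_over X \<and> t \<in> terms_over X"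
  by (auto simp: terms_over_def)

lemma steiner_cong_terms:
  "(s, t) \<in> steiner_cong X \<Longrightarrow> s \<in> terms_over X \<and> t \<in> terms_over X"
  by (induction rule: steiner_cong.induct) auto

lemma equiv_steiner_cong: "equiv (terms_over X) (steiner_cong X)"
proof (rule equivI)
  show "refl_on (terms_over X) (steiner_cong X)"
    by (auto simp: refl_on_def intro: steiner_cong.refl)
  show "sym_on UNIV (steiner_cong X)"
    by (auto intro!: symI intro: steiner_cong.sym)
  show "trans_on UNIV (steiner_cong X)"
    by (auto intro!: transI intro: steiner_cong.trans)
  show "steiner_cong X \<subseteq> terms_over X \<times> terms_over X"
    by (auto dest: steiner_cong_terms)
qed

lemma class_eq_iff:
  "\<lbrakk>s \<in> terms_over X; t \<in> terms_over X\<rbrakk> \<Longrightarrow>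
    steiner_cong X `` {s} = steiner_cong X `` {t} \<longleftrightarrow> (s, t) \<in> steiner_cong X"
  by (rule eq_equiv_class_iff[OF equiv_steiner_cong])

lemma free_one: "\<one>\<^bsub>free_steiner_loop X\<^esub> = steiner_cong X `` {Unit}"
  by (simp add: free_steiner_loop_def)

lemma free_mult:
  assumes "s \<in> terms_over X" "t \<in> terms_over X"
  shows "steiner_cong X `` {s} \<otimes>\<^bsub>free_steiner_loop X\<^esub> steiner_cong X `` {t}
    = steiner_cong X `` {Prod s t}"
proof -
  have "(\<lambda>s t. steiner_cong X `` {Prod s t}) respects2 steiner_cong X"
    by (rule congruent2I', rule equiv_class_eq[OF equiv_steiner_cong], rule steiner_cong.prod)
  from UN_equiv_class2[OF equiv_steiner_cong equiv_steiner_cong this assms]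
  show ?thesis by (simp add: free_steiner_loop_def)
qed

lemma free_carrierI: "t \<in> terms_over X \<Longrightarrow> steiner_cong X `` {t} \<in> carrier (free_steiner_loop X)"
  by (simp add: free_steiner_loop_def quotientI)

lemma free_carrierE:
  assumes "A \<in> carrier (free_steiner_loop X)"
  obtains t where "t \<in> terms_over X" "A = steiner_cong X `` {t}"
  using assms by (auto simp: free_steiner_loop_def elim: quotientE)

lemma steiner_loopI:
  fixes L (structure)
  assumes closed: "\<And>x y. \<lbrakk>x \<in> carrier L; y \<in> carrier L\<rbrakk> \<Longrightarrow> x \<otimes> y \<in> carrier L"
    and one: "\<one> \<in> carrier L"
    and l_one: "\<And>x. x \<in> carrier L \<Longrightarrow> \<one> \<otimes> x = x"
    and comm: "\<And>x y. \<lbrakk>x \<in> carrier L; y \<in> carrier L\<rbrakk> \<Longrightarrow> x \<otimes> y = y \<otimes> x"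
    and sq: "\<And>x. x \<in> carrier L \<Longrightarrow> x \<otimes> x = \<one>"
    and inv: "\<And>x y. \<lbrakk>x \<in> carrier L; y \<in> carrier L\<rbrakk> \<Longrightarrow> x \<otimes> (x \<otimes> y) = y"
  shows "steiner_loop L"
proof
  fix a b assume ab: "a \<in> carrier L" "b \<in> carrier L"
  show *: "\<exists>!x. x \<in> carrier L \<and> a \<otimes> x = b"
  proof (rule ex1I[of _ "a \<otimes> b"])
    show "a \<otimes> b \<in> carrier L \<and> a \<otimes> (a \<otimes> b) = b"
      by (simp add: ab closed inv)
    show "x = a \<otimes> b" if "x \<in> carrier L \<and> a \<otimes> x = b" for x
      using that inv[OF ab(1), of x] by simp
  qed
  show "\<exists>!y. y \<in> carrier L \<and> y \<otimes> a = b"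
    using * by (simp add: comm[OF _ ab(1)] cong: conj_cong)
next
  fix x assume "x \<in> carrier L"
  then show "x \<otimes> \<one> = x"
    using comm[OF _ one] l_one by simp
qed (fact assms)+

theorem free_steiner_loop_is_steiner_loop: "steiner_loop (free_steiner_loop X)"
proof (rule steiner_loopI)
  show "\<one>\<^bsub>free_steiner_loop X\<^esub> \<in> carrier (free_steiner_loop X)"
    by (simp add: free_one free_carrierI)
next
  fix A B
  assume "A \<in> carrier (free_steiner_loop X)" "B \<in> carrier (free_steiner_loop X)"
  then obtain s t where st: "s \<in> terms_over X" "A = steiner_cong X `` {s}"
      "t \<in> terms_over X" "B = steiner_cong X `` {t}"
    by (metis free_carrierE)
  show "A \<otimes>\<^bsub>free_steiner_loop X\<^esub> B \<in> carrier (free_steiner_loop X)"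
    using st by (simp add: free_mult free_carrierI)
  show "A \<otimes>\<^bsub>free_steiner_loop X\<^esub> B = B \<otimes>\<^bsub>free_steiner_loop X\<^esub> A"
    using st by (simp add: free_mult class_eq_iff steiner_cong.comm)
  show "A \<otimes>\<^bsub>free_steiner_loop X\<^esub> (A \<otimes>\<^bsub>free_steiner_loop X\<^esub> B) = B"
    using st by (simp add: free_mult class_eq_iff steiner_cong.left_inverse)
  show "A \<otimes>\<^bsub>free_steiner_loop X\<^esub> A = \<one>\<^bsub>free_steiner_loop X\<^esub>"
    using st by (simp add: free_mult free_one class_eq_iff steiner_cong.square)
  show "\<one>\<^bsub>free_steiner_loop X\<^esub> \<otimes>\<^bsub>free_steiner_loop X\<^esub> A = A"
    using st by (simp add: free_mult free_one class_eq_iff steiner_cong.unit)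
qed

primrec eval_term :: "('b, 'c) monoid_scheme \<Rightarrow> ('a \<Rightarrow> 'b) \<Rightarrow> 'a loop_term \<Rightarrow> 'b" where
  "eval_term H f Unit = \<one>\<^bsub>H\<^esub>"
| "eval_term H f (Gen x) = f x"
| "eval_term H f (Prod s t) = eval_term H f s \<otimes>\<^bsub>H\<^esub> eval_term H f t"

lemma eval_term_closed:
  assumes "steiner_loop H" "f \<in> X \<rightarrow> carrier H" "t \<in> terms_over X"
  shows "eval_term H f t \<in> carrier H"
proof -
  interpret H: steiner_loop H by fact
  show ?thesis using assms(2,3) by (induction t) auto
qed

lemma eval_term_cong:
  assumes "steiner_loop H" "f \<in> X \<rightarrow> carrier H" "(s, t) \<in> steiner_cong X"
  shows "eval_term H f s = eval_term H f t"
proof -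
  interpret H: steiner_loop H by fact
  show ?thesis using assms(3)
    by (induction rule: steiner_cong.induct)
      (auto simp: eval_term_closed[OF assms(1,2)] H.square H.left_inverse intro: H.m_comm)
qed

theorem free_steiner_loop_extend:
  assumes H: "steiner_loop H" and f: "f \<in> X \<rightarrow> carrier H"
  shows "\<exists>h \<in> hom (free_steiner_loop X) H. \<forall>x\<in>X. h (free_gen X x) = f x"
proof -
  define h where "h A = (THE v. \<exists>t\<in>A. v = eval_term H f t)" for A
  have h: "h (steiner_cong X `` {t}) = eval_term H f t" if "t \<in> terms_over X" for t
    unfolding h_def
  proof (rule the_equality)
    show "\<exists>u\<in>steiner_cong X `` {t}. eval_term H f t = eval_term H f u"
      using that by (auto intro: steiner_cong.refl)
  qed (auto dest: eval_term_cong[OF H f])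
  have "h \<in> hom (free_steiner_loop X) H"
    by (rule homI) (auto elim!: free_carrierE simp: h free_mult eval_term_closed[OF H f])
  moreover have "\<forall>x\<in>X. h (free_gen X x) = f x"
    by (simp add: free_gen_def h)
  ultimately show ?thesis by blast
qed

theorem free_steiner_loop_unique:
  assumes H: "steiner_loop H"
    and h: "h \<in> hom (free_steiner_loop X) H" "h' \<in> hom (free_steiner_loop X) H"
    and eq: "\<And>x. x \<in> X \<Longrightarrow> h (free_gen X x) = h' (free_gen X x)"
    and A: "A \<in> carrier (free_steiner_loop X)"
  shows "h A = h' A"
proof -
  interpret H: steiner_loop H by fact
  interpret F: steiner_loop "free_steiner_loop X" by (rule free_steiner_loop_is_steiner_loop)
  have one: "g \<one>\<^bsub>free_steiner_loop X\<^esub> = \<one>\<^bsub>H\<^esub>" if "g \<in> hom (free_steiner_loop X) H" for g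
  proof -
    have "g \<one>\<^bsub>free_steiner_loop X\<^esub> \<in> carrier H"
      using that F.one_closed by (auto simp: hom_def)
    moreover have "g \<one>\<^bsub>free_steiner_loop X\<^esub> =
        g \<one>\<^bsub>free_steiner_loop X\<^esub> \<otimes>\<^bsub>H\<^esub> g \<one>\<^bsub>free_steiner_loop X\<^esub>"
      using hom_mult[OF that F.one_closed F.one_closed] by simp
    ultimately show ?thesis by (simp add: H.square)
  qed
  obtain t where t: "t \<in> terms_over X" "A = steiner_cong X `` {t}"
    using A by (rule free_carrierE)
  from t(1) have "h (steiner_cong X `` {t}) = h' (steiner_cong X `` {t})"
  proof (induction t)
    case Unit
    then show ?case using one[OF h(1)] one[OF h(2)] by (simp add: free_one)
  next
    case (Gen x)
    then show ?case using eq by (simp add: free_gen_def)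
  next
    case (Prod s t)
    then have "s \<in> terms_over X" "t \<in> terms_over X" by auto
    then show ?case
      using Prod hom_mult[OF h(1) free_carrierI free_carrierI, of s t]
        hom_mult[OF h(2) free_carrierI free_carrierI, of s t]
      by (simp add: free_mult)
  qed
  with t show ?thesis by simp
qed

theorem inj_on_free_gen: "inj_on (free_gen X) X"
proof
  fix x y assume xy: "x \<in> X" "y \<in> X" "free_gen X x = free_gen X y"
  define H :: "bool monoid" where
    "H = \<lparr>carrier = UNIV, mult = (\<lambda>a b. a \<noteq> b), one = False\<rparr>"
  have "steiner_loop H"
    by (rule steiner_loopI) (auto simp: H_def)
  moreover have "(\<lambda>z. z = x) \<in> X \<rightarrow> carrier H"
    by (simp add: H_def)
  ultimately obtain h where h: "\<forall>z\<in>X. h (free_gen X z) = (z = x)"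
    using free_steiner_loop_extend[of H "\<lambda>z. z = x" X] by blast
  have "h (free_gen X x)" using h xy(1) by simp
  then have "h (free_gen X y)" by (simp only: xy(3))
  then show "x = y" using h xy(2) by simp
qed

theorem (in steiner_loop) AutoGroup: "group (AutoGroup L)"
proof -
  have "subgroup (auto L) (BijGroup (carrier L))"
  proof (rule subgroup.intro)
    show "auto L \<subseteq> carrier (BijGroup (carrier L))"
      by (simp add: auto_def BijGroup_def)
    show "\<one>\<^bsub>BijGroup (carrier L)\<^esub> \<in> auto L"
      by (simp add: BijGroup_def auto_def hom_def id_Bij)
  next
    fix f g assume fg: "f \<in> auto L" "g \<in> auto L"
    then have "compose (carrier L) f g \<in> hom L L"
      by (auto simp: auto_def hom_def compose_def Pi_def)
    with fg show "f \<otimes>\<^bsub>BijGroup (carrier L)\<^esub> g \<in> auto L"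
      by (simp add: BijGroup_def auto_def compose_Bij)
  next
    fix f assume f: "f \<in> auto L"
    then have fB: "f \<in> Bij (carrier L)"
      and hom: "\<And>x y. \<lbrakk>x \<in> carrier L; y \<in> carrier L\<rbrakk> \<Longrightarrow> f (x \<otimes> y) = f x \<otimes> f y"
      by (auto simp: auto_def hom_def)
    have "restrict (inv_into (carrier L) f) (carrier L) \<in> hom L L"
      using Bij_inv_into_lemma[where g = "(\<otimes>)", OF hom fB] Bij_inv_into_mem[OF fB]
      by (auto simp: hom_def)
    with fB show "inv\<^bsub>BijGroup (carrier L)\<^esub> f \<in> auto L"
      by (simp add: inv_BijGroup auto_def restrict_inv_into_Bij)
  qed
  then show ?thesis
    by (simp add: AutoGroup_def subgroup.subgroup_is_group group_BijGroup)
qed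

end

(* Call the triples {a, b, ab} of distinct non-unit elements lines. Every non-unit element of the
   free loop is a generator or, uniquely, a reduced product of two shorter ones; hence every line
   has exactly one longest point, its top. An automorphism g moves tops to tops on all but
   finitely many lines, because lines on which it fails to do so have short images. The set of
   automorphisms that respect the tops of all lines meeting a fixed invariant set K is a group.
   Given finitely many automorphisms, residual finiteness yields a finite quotient Q such that
   K = {u. every homomorphism to Q kills u} avoids the finitely many bad lines, so a finitely
   generated automorphism group respects the tops of all lines meeting K. But Q is finite and there
   are infinitely many elements that do not involve a generator x (here |X| > 3 is used), so K
   contains such an element w, and the automorphism x |-> xw exchanges the top xw of the line
   {x, w, xw} with x. *)

theory Submission
  imports Defs "HOL-Library.Multiset"
begin

section \<open>Reduced trees\<close>

text \<open>Only nodes with exactly two distinct children occur in \<open>reduced_trees\<close>; the multiset makes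
  the product commutative.\<close>

datatype 'a tree = Empty | Leaf 'a | Node "'a tree multiset"

primrec leaves :: "'a tree \<Rightarrow> nat" where
  "leaves Empty = 0"
| "leaves (Leaf x) = 1"
| "leaves (Node m) = sum_mset (image_mset leaves m)"

lemma mset_pair_eq_iff:
  "{#a, b#} = {#c, d#} \<longleftrightarrow> (a = c \<and> b = d) \<or> (a = d \<and> b = c)"
  by (auto simp: add_eq_conv_ex)

inductive_set reduced_trees :: "'a set \<Rightarrow> 'a tree set" for X :: "'a set" where
  Empty: "Empty \<in> reduced_trees X"
| Leaf: "x \<in> X \<Longrightarrow> Leaf x \<in> reduced_trees X"
| Node: "\<lbrakk>a \<in> reduced_trees X; b \<in> reduced_trees X; a \<noteq> Empty; b \<noteq> Empty; a \<noteq> b;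
    \<And>c. b \<noteq> Node {#a, c#}; \<And>c. a \<noteq> Node {#b, c#}\<rbrakk> \<Longrightarrow> Node {#a, b#} \<in> reduced_trees X"

text \<open>Mirrors the Steiner laws as reductions: the two \<open>THE\<close> clauses are the law
  a(ac) = c, with the node as second or as first factor.\<close>

definition tree_mult :: "'a tree \<Rightarrow> 'a tree \<Rightarrow> 'a tree" where
  "tree_mult a b =
    (if a = Empty then b else if b = Empty then a else if a = b then Empty
     else if \<exists>c. b = Node {#a, c#} then THE c. b = Node {#a, c#}
     else if \<exists>c. a = Node {#b, c#} then THE c. a = Node {#b, c#}
     else Node {#a, b#})"

definition tree_loop :: "'a set \<Rightarrow> 'a tree monoid" where
  "tree_loop X = \<lparr>carrier = reduced_trees X, monoid.mult = tree_mult, one = Empty\<rparr>"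

lemma leaves_pos: "a \<in> reduced_trees X \<Longrightarrow> a \<noteq> Empty \<Longrightarrow> leaves a > 0"
  by (induction rule: reduced_trees.induct) auto

lemma reduced_NodeD:
  assumes "Node {#a, b#} \<in> reduced_trees X"
  shows "a \<in> reduced_trees X" "b \<in> reduced_trees X" "a \<noteq> Empty" "b \<noteq> Empty" "a \<noteq> b"
    "b \<noteq> Node {#a, c#}" "a \<noteq> Node {#b, c#}"
  using assms by (cases rule: reduced_trees.cases; auto simp: mset_pair_eq_iff)+

lemma leaves_child_less:
  assumes "Node {#a, b#} \<in> reduced_trees X"
  shows "leaves a < leaves (Node {#a, b#})" "leaves b < leaves (Node {#a, b#})"
  using reduced_NodeD[OF assms] leaves_pos[of a X] leaves_pos[of b X] by auto

lemma tree_mult_cases: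
  assumes "a \<in> reduced_trees X" "b \<in> reduced_trees X"
  obtains "a = Empty" "tree_mult a b = b"
  | "b = Empty" "tree_mult a b = a"
  | "a = b" "tree_mult a b = Empty"
  | c where "a \<noteq> Empty" "a \<noteq> b" "b = Node {#a, c#}" "tree_mult a b = c"
  | c where "b \<noteq> Empty" "a \<noteq> b" "a = Node {#b, c#}" "tree_mult a b = c"
  | "a \<noteq> Empty" "b \<noteq> Empty" "a \<noteq> b" "Node {#a, b#} \<in> reduced_trees X"
    "tree_mult a b = Node {#a, b#}"
proof (cases "a = Empty \<or> b = Empty \<or> a = b")
  case True
  then show ?thesis using that(1-3) by (auto simp: tree_mult_def)
next
  case nontriv: False
  have the: "(THE c'. Node {#d, c#} = Node {#d, c'#}) = c" for c d :: "'a tree"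
    by (rule the_equality) (auto simp: mset_pair_eq_iff)
  consider c where "b = Node {#a, c#}" | c where "a = Node {#b, c#}" "\<forall>c. b \<noteq> Node {#a, c#}"
    | "\<forall>c. b \<noteq> Node {#a, c#}" "\<forall>c. a \<noteq> Node {#b, c#}" by blast
  then show ?thesis
  proof cases
    case 1
    then have "tree_mult a b = c" using nontriv the[of a c] by (auto simp: tree_mult_def)
    with 1 nontriv show ?thesis using that(4) by blast
  next
    case 2
    then have "tree_mult a b = c" using nontriv the[of b c] by (auto simp: tree_mult_def)
    with 2 nontriv show ?thesis using that(5) by blast
  next
    case 3
    then have "tree_mult a b = Node {#a, b#}" using nontriv by (auto simp: tree_mult_def)
    moreover have "Node {#a, b#} \<in> reduced_trees X"
      using 3 nontriv assms by (intro reduced_trees.Node) auto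
    ultimately show ?thesis using nontriv that(6) by blast
  qed
qed

lemma tree_mult_left_child: "Node {#a, c#} \<in> reduced_trees X \<Longrightarrow> tree_mult a (Node {#a, c#}) = c"
proof -
  assume *: "Node {#a, c#} \<in> reduced_trees X"
  then have "a \<noteq> Node {#a, c#}" using leaves_child_less(1) by (metis less_irrefl)
  then show ?thesis using reduced_NodeD(3)[OF *] by (auto simp: tree_mult_def mset_pair_eq_iff)
qed

lemma tree_mult_Node: "Node {#a, c#} \<in> reduced_trees X \<Longrightarrow> tree_mult a c = Node {#a, c#}"
  using reduced_NodeD[of a c X] by (auto simp: tree_mult_def)

text \<open>Swapping the factors only exchanges the two cancellation clauses; both cannot apply at
  once, since a child has fewer leaves than its node.\<close>

lemma tree_mult_commute:
  assumes "a \<in> reduced_trees X" "b \<in> reduced_trees X"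
  shows "tree_mult a b = tree_mult b a"
proof -
  have *: False if "b = Node {#a, c#}" "a = Node {#b, d#}" for c d
    using that leaves_child_less[of a c X] leaves_child_less[of b d X] assms by auto
  show ?thesis
  proof (cases "\<exists>c. b = Node {#a, c#}")
    case True
    with * have "\<nexists>c. a = Node {#b, c#}" by blast
    with True show ?thesis by (simp add: tree_mult_def eq_commute[of b a])
  next
    case False
    then show ?thesis by (simp add: tree_mult_def eq_commute[of b a] add_mset_commute[of b a])
  qed
qed

text \<open>Once reduced trees form a Steiner loop, the universal property maps the free loop to
  normal forms; this replaces a confluence argument.\<close>

lemma steiner_loop_tree_loop: "steiner_loop (tree_loop X)"
proof (rule steiner_loopI)
  fix a b assume "a \<in> carrier (tree_loop X)" "b \<in> carrier (tree_loop X)"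
  then have ab: "a \<in> reduced_trees X" "b \<in> reduced_trees X" by (auto simp: tree_loop_def)
  then show "a \<otimes>\<^bsub>tree_loop X\<^esub> b = b \<otimes>\<^bsub>tree_loop X\<^esub> a"
    by (simp add: tree_loop_def tree_mult_commute[of _ X])
  have "tree_mult a b \<in> reduced_trees X \<and> tree_mult a (tree_mult a b) = b"
    using ab
  proof (cases rule: tree_mult_cases)
    case (4 c)
    then show ?thesis using ab reduced_NodeD[of a c X] tree_mult_Node[of a c X] by simp
  next
    case (5 c)
    then have a: "Node {#c, b#} \<in> reduced_trees X" "a = Node {#c, b#}"
      using ab by (simp_all add: add_mset_commute)
    then have c: "c \<in> reduced_trees X" using reduced_NodeD(1) by blast
    have "tree_mult a c = b"
      using tree_mult_commute[OF ab(1) c] tree_mult_left_child[OF a(1)] a(2) by simp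
    with 5 c show ?thesis by simp
  next
    case 6
    then show ?thesis using tree_mult_left_child by metis
  qed (use ab in \<open>auto simp: tree_mult_def intro: reduced_trees.Empty\<close>)
  then show "a \<otimes>\<^bsub>tree_loop X\<^esub> b \<in> carrier (tree_loop X)"
    "a \<otimes>\<^bsub>tree_loop X\<^esub> (a \<otimes>\<^bsub>tree_loop X\<^esub> b) = b"
    by (auto simp: tree_loop_def)
qed (auto simp: tree_loop_def tree_mult_def intro: reduced_trees.Empty)

section \<open>Length and unique decomposition\<close>

locale free_steiner =
  fixes X :: "'a set"
begin

abbreviation F where "F \<equiv> free_steiner_loop X"
abbreviation C where "C \<equiv> carrier F"
abbreviation mul (infixl \<open>\<cdot>\<close> 70) where "a \<cdot> b \<equiv> a \<otimes>\<^bsub>F\<^esub> b"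
abbreviation e where "e \<equiv> \<one>\<^bsub>F\<^esub>"
abbreviation gens where "gens \<equiv> free_gen X ` X"

sublocale F: steiner_loop F
  by (rule free_steiner_loop_is_steiner_loop)

lemma gens_carrier: "gens \<subseteq> C"
  by (auto simp: free_gen_def intro!: free_carrierI)

lemma mult_cancel:
  assumes "a \<in> C" "b \<in> C"
  shows "a \<cdot> (a \<cdot> b) = b" "b \<cdot> (a \<cdot> b) = a" "a \<cdot> b \<cdot> a = b" "a \<cdot> b \<cdot> b = a"
  using assms F.left_inverse F.m_comm by (metis F.m_closed)+

lemma carrier_induct [consumes 1, case_names one gen mult]:
  assumes "A \<in> C" "P e" "\<And>g. g \<in> gens \<Longrightarrow> P g"
    "\<And>a b. \<lbrakk>a \<in> C; b \<in> C; P a; P b\<rbrakk> \<Longrightarrow> P (a \<cdot> b)"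
  shows "P A"
proof -
  obtain t where t: "t \<in> terms_over X" "A = steiner_cong X `` {t}"
    using assms(1) by (rule free_carrierE)
  from t(1) have "P (steiner_cong X `` {t})"
  proof (induction t)
    case Unit
    then show ?case using assms(2) by (simp add: free_one)
  next
    case (Gen x)
    then show ?case using assms(3) by (auto simp: free_gen_def)
  next
    case (Prod s t)
    then show ?case using assms(4)[OF free_carrierI free_carrierI, of s t] by (simp add: free_mult)
  qed
  with t show ?thesis by simp
qed

section \<open>Normal forms in the free loop\<close>

text \<open>The extension theorem yields existence only, hence \<open>SOME\<close>; on
  \<open>C\<close> the choice is unique by freeness.\<close>

definition nf :: "'a loop_term set \<Rightarrow> 'a tree" where
  "nf = (SOME h. h \<in> hom F (tree_loop X) \<and> (\<forall>x\<in>X. h (free_gen X x) = Leaf x))"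

lemma nf_hom: "nf \<in> hom F (tree_loop X)" and nf_gen: "x \<in> X \<Longrightarrow> nf (free_gen X x) = Leaf x"
proof -
  have "\<exists>h. h \<in> hom F (tree_loop X) \<and> (\<forall>x\<in>X. h (free_gen X x) = Leaf x)"
    using free_steiner_loop_extend[OF steiner_loop_tree_loop[of X], of Leaf X]
    by (auto simp: tree_loop_def intro: reduced_trees.Leaf)
  from someI_ex[OF this]
  show "nf \<in> hom F (tree_loop X)" "x \<in> X \<Longrightarrow> nf (free_gen X x) = Leaf x"
    unfolding nf_def by auto
qed

lemma nf_closed: "a \<in> C \<Longrightarrow> nf a \<in> reduced_trees X"
  and nf_mult: "\<lbrakk>a \<in> C; b \<in> C\<rbrakk> \<Longrightarrow> nf (a \<cdot> b) = tree_mult (nf a) (nf b)"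
  using nf_hom by (auto simp: hom_def tree_loop_def)

lemma nf_one: "nf e = Empty"
  using nf_mult[OF F.one_closed F.one_closed] by (simp add: tree_mult_def split: if_splits)

text \<open>On elements built without any cancellation \<open>nf\<close> is visibly injective; that these are all
  elements (\<open>carrier_eq_nf_reachable\<close>) makes the trees normal forms.\<close>

inductive_set nf_reachable :: "'a loop_term set set" where
  one: "e \<in> nf_reachable"
| gen: "g \<in> gens \<Longrightarrow> g \<in> nf_reachable"
| mult: "\<lbrakk>a \<in> nf_reachable; b \<in> nf_reachable; nf (a \<cdot> b) = Node {#nf a, nf b#}\<rbrakk>
    \<Longrightarrow> a \<cdot> b \<in> nf_reachable"

lemma nf_reachable_closed: "a \<in> nf_reachable \<Longrightarrow> a \<in> C"
  by (induction rule: nf_reachable.induct) (use gens_carrier in auto)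

lemma nf_reachable_NodeE:
  assumes "u \<in> nf_reachable" "nf u = Node {#p, q#}"
  obtains a b where "a \<in> nf_reachable" "b \<in> nf_reachable" "u = a \<cdot> b" "nf a = p" "nf b = q"
  using assms(1)
proof (cases rule: nf_reachable.cases)
  case (mult a b)
  then show ?thesis
    using that[of a b] that[of b a] assms(2) F.m_comm[of a b] nf_reachable_closed
    by (auto simp: mset_pair_eq_iff)
qed (use assms(2) nf_one nf_gen in auto)

text \<open>The root of the tree reveals which rule built the element, and its children determine
  the factors by induction.\<close>

lemma nf_inj_reachable: "\<lbrakk>a \<in> nf_reachable; b \<in> nf_reachable; nf a = nf b\<rbrakk> \<Longrightarrow> a = b"
proof (induction arbitrary: b rule: nf_reachable.induct)
  case one
  from one(1) show ?case
    by (cases rule: nf_reachable.cases) (use one nf_one nf_gen in auto)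
next
  case (gen g)
  from gen(2) show ?case
    by (cases rule: nf_reachable.cases) (use gen nf_one nf_gen in auto)
next
  case (mult a1 a2)
  from mult.prems mult.hyps obtain b1 b2 where
    "b1 \<in> nf_reachable" "b2 \<in> nf_reachable" "b = b1 \<cdot> b2" "nf b1 = nf a1" "nf b2 = nf a2"
    by (metis nf_reachable_NodeE)
  with mult.IH show ?case by metis
qed

text \<open>Where the trees cancel, injectivity on reachable elements turns the cancellation into an
  identity of the loop; where they do not, the rule \<open>mult\<close> applies.\<close>

lemma nf_reachable_mult:
  assumes a: "a \<in> nf_reachable" and b: "b \<in> nf_reachable"
  shows "a \<cdot> b \<in> nf_reachable"
proof -
  note cl = nf_reachable_closed
  have E: "c = e" if "c \<in> nf_reachable" "nf c = Empty" for c
    using that nf_inj_reachable[OF that(1) nf_reachable.one] nf_one by simp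
  \<comment> \<open>If \<open>nf u\<close> is a child of \<open>nf v\<close>, then u is itself a
    factor of v, and u(uc) = c leaves the other factor, which is reachable.\<close>
  have child: "u \<cdot> v \<in> nf_reachable"
    if u: "u \<in> nf_reachable" and v: "v \<in> nf_reachable" and uv: "nf v = Node {#nf u, c#}"
    for u v c
  proof -
    obtain v1 v2 where "v1 \<in> nf_reachable" "v2 \<in> nf_reachable" "v = v1 \<cdot> v2" "nf v1 = nf u"
      using nf_reachable_NodeE[OF v uv] by metis
    moreover from this u have "v1 = u" using nf_inj_reachable by blast
    ultimately show ?thesis by (simp add: F.left_inverse cl)
  qed
  show ?thesis using nf_closed[OF cl[OF a]] nf_closed[OF cl[OF b]]
  proof (cases rule: tree_mult_cases)
    case 1
    then show ?thesis using E[OF a] b cl by simp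
  next
    case 2
    then show ?thesis using E[OF b] a cl by simp
  next
    case 3
    then show ?thesis using nf_inj_reachable[OF a b] a cl by (simp add: F.square nf_reachable.one)
  next
    case (4 c)
    then show ?thesis using child a b by blast
  next
    case (5 c)
    then show ?thesis using child[OF b a] F.m_comm[OF cl[OF a] cl[OF b]] by simp
  next
    case 6
    then show ?thesis using a b nf_mult cl by (auto intro: nf_reachable.mult)
  qed
qed

lemma carrier_eq_nf_reachable: "C = nf_reachable"
proof
  show "C \<subseteq> nf_reachable"
  proof
    fix A assume "A \<in> C"
    then show "A \<in> nf_reachable"
      by (induction rule: carrier_induct) (auto intro: nf_reachable.intros nf_reachable_mult)
  qed
qed (auto intro: nf_reachable_closed)

lemma nf_inj: "\<lbrakk>a \<in> C; b \<in> C; nf a = nf b\<rbrakk> \<Longrightarrow> a = b"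
  using nf_inj_reachable by (simp add: carrier_eq_nf_reachable)

section \<open>Length, tops of lines and uniqueness of reduced factors\<close>

definition len :: "'a loop_term set \<Rightarrow> nat" where
  "len a = leaves (nf a)"

lemma len_one [simp]: "len e = 0"
  by (simp add: len_def nf_one)

lemma len_gen: "g \<in> gens \<Longrightarrow> len g = 1"
  by (auto simp: len_def nf_gen)

lemma len_eq_0_iff: "a \<in> C \<Longrightarrow> len a = 0 \<longleftrightarrow> a = e"
  using leaves_pos[OF nf_closed, of a] nf_inj[of a e] nf_one
  by (metis F.one_closed len_def len_one less_irrefl)

lemma mult_eq_one_iff: "\<lbrakk>a \<in> C; b \<in> C\<rbrakk> \<Longrightarrow> a \<cdot> b = e \<longleftrightarrow> a = b"
  by (metis F.left_inverse F.r_one F.square)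

text \<open>The cases of \<open>tree_mult\<close> decide which point of the line is the node over
  the other two, that is, its top.\<close>

lemma len_mult_cases:
  assumes "a \<in> C" "b \<in> C" "a \<noteq> e" "b \<noteq> e" "a \<noteq> b"
  shows "len (a \<cdot> b) = len a + len b \<or> len b = len a + len (a \<cdot> b) \<or> len a = len b + len (a \<cdot> b)"
proof -
  have "nf a \<noteq> Empty" "nf b \<noteq> Empty" "nf a \<noteq> nf b"
    using assms nf_inj[of _ e] nf_one nf_inj[of a b] by auto
  with nf_closed[OF assms(1)] nf_closed[OF assms(2)] show ?thesis
    by (cases rule: tree_mult_cases) (auto simp: len_def nf_mult assms)
qed

lemma len_mult_le:
  assumes "a \<in> C" "b \<in> C"
  shows "len (a \<cdot> b) \<le> len a + len b"
  using len_mult_cases[of a b] assms F.square by fastforce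

lemma nf_mult_reduced:
  assumes "a \<in> C" "b \<in> C" "a \<noteq> e" "b \<noteq> e" "len (a \<cdot> b) = len a + len b"
  shows "nf (a \<cdot> b) = Node {#nf a, nf b#}"
proof -
  have "nf a \<noteq> Empty" "nf b \<noteq> Empty" "len a > 0" "len b > 0"
    using assms nf_inj[of _ e] nf_one len_eq_0_iff by auto
  with nf_closed[OF assms(1)] nf_closed[OF assms(2)] assms(5) show ?thesis
    by (cases rule: tree_mult_cases) (auto simp: len_def nf_mult assms)
qed

text \<open>Both products have the same normal form, a node whose children are the normal forms of
  the factors.\<close>

lemma reduced_unique:
  assumes "a \<in> C" "b \<in> C" "a \<noteq> e" "b \<noteq> e" "len (a \<cdot> b) = len a + len b"
    "c \<in> C" "d \<in> C" "c \<noteq> e" "d \<noteq> e" "len (c \<cdot> d) = len c + len d" "a \<cdot> b = c \<cdot> d"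
  shows "a = c \<or> a = d"
  using nf_mult_reduced[OF assms(1-5)] nf_mult_reduced[OF assms(6-10)] assms(1,6,7,11) nf_inj
  by (auto simp: mset_pair_eq_iff)

lemma decompose:
  assumes "u \<in> C" "u \<noteq> e" "u \<notin> gens"
  obtains a b where "a \<in> C" "b \<in> C" "a \<noteq> e" "b \<noteq> e" "u = a \<cdot> b" "len (a \<cdot> b) = len a + len b"
proof -
  have "u \<in> nf_reachable" using assms carrier_eq_nf_reachable by simp
  then show ?thesis
  proof (cases rule: nf_reachable.cases)
    case (mult a b)
    then have "a \<in> C" "b \<in> C" using carrier_eq_nf_reachable by auto
    moreover from this mult have "a \<noteq> e" "b \<noteq> e"
      using nf_closed[of u] assms(1) reduced_NodeD[of "nf a" "nf b" X] nf_one by auto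
    ultimately show ?thesis using that mult by (simp add: len_def)
  qed (use assms in auto)
qed

lemma finite_ball:
  assumes "finite X"
  shows "finite {u \<in> C. len u \<le> n}"
proof (induction n)
  case 0
  have "{u \<in> C. len u \<le> 0} \<subseteq> {e}" using len_eq_0_iff by auto
  then show ?case by (rule finite_subset) simp
next
  case (Suc n)
  let ?B = "{u \<in> C. len u \<le> n}"
  have "{u \<in> C. len u \<le> Suc n} \<subseteq> insert e (gens \<union> (\<lambda>(a, b). a \<cdot> b) ` (?B \<times> ?B))"
  proof
    fix u assume u: "u \<in> {u \<in> C. len u \<le> Suc n}"
    show "u \<in> insert e (gens \<union> (\<lambda>(a, b). a \<cdot> b) ` (?B \<times> ?B))"
    proof (cases "u = e \<or> u \<in> gens")
      case False
      then obtain a b where ab: "a \<in> C" "b \<in> C" "a \<noteq> e" "b \<noteq> e" "u = a \<cdot> b"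
        "len (a \<cdot> b) = len a + len b"
        using decompose u by blast
      moreover have "len a > 0" "len b > 0" using ab len_eq_0_iff by auto
      ultimately have "(a, b) \<in> ?B \<times> ?B" using u by auto
      with ab(5) show ?thesis by auto
    qed auto
  qed
  then show ?case by (rule finite_subset) (use Suc assms in auto)
qed

section \<open>Endomorphisms and their effect on length\<close>

lemma hom_closed: "\<lbrakk>g \<in> hom F F; a \<in> C\<rbrakk> \<Longrightarrow> g a \<in> C"
  by (auto simp: hom_def)

lemma hom_one: "g \<in> hom F F \<Longrightarrow> g e = e"
  by (metis F.one_closed F.square hom_closed hom_mult)

lemma hom_eqI:
  assumes "g \<in> hom F F" "h \<in> hom F F" "\<And>x. x \<in> gens \<Longrightarrow> g x = h x" "u \<in> C"
  shows "g u = h u"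
  using assms(4,3)
  by (induction rule: carrier_induct)
    (simp_all add: hom_one[OF assms(1)] hom_one[OF assms(2)]
      hom_mult[OF assms(1)] hom_mult[OF assms(2)])

lemma hom_extend:
  assumes "f \<in> gens \<rightarrow> C"
  obtains g where "g \<in> hom F F" "\<And>x. x \<in> gens \<Longrightarrow> g x = f x"
  using free_steiner_loop_extend[OF F.steiner_loop_axioms, of "\<lambda>x. f (free_gen X x)" X] assms
  by fastforce

text \<open>The bound 1 admits generators sent to the unit, as for the map that deletes a
  generator.\<close>

lemma len_hom_le:
  assumes g: "g \<in> hom F F" and gen: "\<And>x. x \<in> gens \<Longrightarrow> len (g x) \<le> 1" and "u \<in> C"
  shows "len (g u) \<le> len u"
  using assms(3)
proof (induction "len u" arbitrary: u rule: less_induct)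
  case less
  show ?case
  proof (cases "u = e \<or> u \<in> gens")
    case True
    then show ?thesis using gen hom_one[OF g] len_gen by fastforce
  next
    case False
    then obtain a b where ab: "a \<in> C" "b \<in> C" "a \<noteq> e" "b \<noteq> e" "u = a \<cdot> b"
      "len (a \<cdot> b) = len a + len b"
      using decompose less.prems by blast
    moreover have "len a > 0" "len b > 0" using ab len_eq_0_iff by auto
    ultimately have "len (g a) \<le> len a" "len (g b) \<le> len b" using less.hyps by auto
    then show ?thesis
      using len_mult_le[of "g a" "g b"] ab g by (simp add: hom_mult hom_closed)
  qed
qed

text \<open>The hypothesis says that \<open>g\<close> moves the top of the line through \<open>s\<close>, \<open>t\<close> from \<open>s \<cdot> t\<close> to \<open>s\<close>.
  If \<open>g s\<close> were longer than \<open>M\<close>, then \<open>s\<close> would itself be a reduced product, and unique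
  decomposition of \<open>g s\<close> would make \<open>t\<close> one of its factors.\<close>

lemma cancelled_image_bound:
  assumes g: "g \<in> hom F F" "inj_on g C" and gen: "\<And>x. x \<in> gens \<Longrightarrow> len (g x) \<le> M"
    and "s \<in> C" "t \<in> C" "s \<noteq> e" "t \<noteq> e" "len (s \<cdot> t) = len s + len t"
    and "len (g s) = len (g t) + len (g (s \<cdot> t))"
  shows "len (g s) \<le> M"
  using assms(4-9)
proof (induction "len s" arbitrary: s t rule: less_induct)
  case less
  have nontriv: "g a \<noteq> e" if "a \<in> C" "a \<noteq> e" for a
    using that inj_onD[OF g(2), of a e] hom_one[OF g(1)] by auto
  have pos: "len a > 0" if "a \<in> C" "a \<noteq> e" for a
    using that len_eq_0_iff by auto
  have gpos: "len (g a) > 0" if "a \<in> C" "a \<noteq> e" for a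
    using that nontriv pos hom_closed[OF g(1)] by simp
  have st: "s \<noteq> t" using less.prems pos F.square by fastforce
  then have st': "s \<cdot> t \<in> C" "s \<cdot> t \<noteq> e" using less.prems mult_eq_one_iff by auto
  show ?case
  proof (rule ccontr)
    assume M: "\<not> len (g s) \<le> M"
    then have "s \<notin> gens" using gen by auto
    then obtain a b where ab: "a \<in> C" "b \<in> C" "a \<noteq> e" "b \<noteq> e" "s = a \<cdot> b"
      "len (a \<cdot> b) = len a + len b"
      using decompose less.prems by blast
    have less_s: "len a < len s" "len b < len s" using ab pos by auto
    have "a \<noteq> b" using ab less.prems F.square by auto
    then have gab: "g a \<noteq> g b" using ab g inj_onD by metis
    have gs: "g s = g a \<cdot> g b" using ab g hom_mult by metis
    \<comment> \<open>Here g s is reduced in two ways, so t is a or b. Then st is the other factor,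
      shorter than s, although st is the top over s.\<close>
    have False if red: "len (g s) = len (g a) + len (g b)"
    proof -
      have "g t \<cdot> g (s \<cdot> t) = g s"
        using mult_cancel[of "g s" "g t"] hom_closed[OF g(1)] hom_mult[OF g(1)] less.prems by simp
      then have "g t = g a \<or> g t = g b"
        using reduced_unique[of "g t" "g (s \<cdot> t)" "g a" "g b"] red less.prems(6) gs ab st' less.prems
          nontriv hom_closed[OF g(1)] by metis
      then have "t = a \<or> t = b" using inj_onD[OF g(2)] ab less.prems by metis
      then have "s \<cdot> t = b \<or> s \<cdot> t = a"
        using ab mult_cancel[of a b] by metis
      then show False using less_s less.prems pos by fastforce
    qed
    \<comment> \<open>The pair a, b satisfies the hypotheses with a shorter than s; the bound on g a
      passes to the shorter g s.\<close>
    moreover have False if red: "len (g a) = len (g b) + len (g s)"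
    proof -
      have "len (g a) \<le> M"
        using less.hyps[OF less_s(1) ab(1,2,3,4)] ab red by simp
      then show False using M red by simp
    qed
    moreover have False if red: "len (g b) = len (g a) + len (g s)"
    proof -
      have "len (g b) \<le> M"
        using less.hyps[OF less_s(2) ab(2,1,4,3)] ab red F.m_comm[OF ab(1,2)] by simp
      then show False using M red by simp
    qed
    ultimately show False
      using len_mult_cases[of "g a" "g b"] gab gs nontriv ab hom_closed[OF g(1)] by metis
  qed
qed

section \<open>Residual finiteness\<close>

text \<open>A function \<open>f\<close> on the lines, extended by \<open>False\<close> to degenerate triples, is exactly a cocycle for
  a central extension of Steiner loops by the group of order two.\<close>

lemma twisted_hom_exists:
  assumes f_comm: "\<And>a b. \<lbrakk>a \<in> C; b \<in> C\<rbrakk> \<Longrightarrow> f a b = f b a"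
    and f_sq: "\<And>a. a \<in> C \<Longrightarrow> \<not> f a a" and f_one: "\<And>a. a \<in> C \<Longrightarrow> \<not> f e a"
    and f_line: "\<And>a b. \<lbrakk>a \<in> C; b \<in> C\<rbrakk> \<Longrightarrow> f a (a \<cdot> b) = f a b"
  obtains z :: "'a loop_term set \<Rightarrow> bool"
  where "\<And>x. x \<in> gens \<Longrightarrow> z x = v x"
    "\<And>a b. \<lbrakk>a \<in> C; b \<in> C\<rbrakk> \<Longrightarrow> z (a \<cdot> b) = (z a \<noteq> (z b \<noteq> f a b))"
proof -
  define H :: "('a loop_term set \<times> bool) monoid" where
    "H = \<lparr>carrier = C \<times> UNIV,
      monoid.mult = (\<lambda>(a, s) (b, t). (a \<cdot> b, s \<noteq> (t \<noteq> f a b))), one = (e, False)\<rparr>"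
  have f_one': "\<not> f a e" if "a \<in> C" for a using f_comm[OF that F.one_closed] f_one that by simp
  have H: "steiner_loop H"
    by (rule steiner_loopI)
      (auto simp: H_def F.m_comm F.square F.left_inverse f_sq f_one f_one' f_line f_comm)
  have "(\<lambda>x. (free_gen X x, v (free_gen X x))) \<in> X \<rightarrow> carrier H"
    using gens_carrier by (auto simp: H_def)
  from free_steiner_loop_extend[OF H this] obtain h where
    h: "h \<in> hom F H" "\<And>x. x \<in> gens \<Longrightarrow> h x = (x, v x)" by auto
  have hmult: "h (a \<cdot> b) = h a \<otimes>\<^bsub>H\<^esub> h b" if "a \<in> C" "b \<in> C" for a b
    using h(1) that by (rule hom_mult)
  have hcl: "fst (h a) \<in> C" if "a \<in> C" for a
    using h(1) that by (auto simp: hom_def H_def Pi_iff mem_Times_iff)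
  \<comment> \<open>The first component of h is an endomorphism fixing the generators, hence the
    identity; the second component is the required z.\<close>
  have "(\<lambda>a. fst (h a)) \<in> hom F F"
    by (rule homI) (auto simp: hcl hmult H_def split: prod.splits)
  moreover have "(\<lambda>a. a) \<in> hom F F" by (rule homI) auto
  ultimately have fst: "fst (h a) = a" if "a \<in> C" for a
    using hom_eqI[of "\<lambda>a. fst (h a)" "\<lambda>a. a" a] h(2) that by simp
  show ?thesis
  proof
    show "snd (h x) = v x" if "x \<in> gens" for x using h(2) that by simp
    show "snd (h (a \<cdot> b)) = (snd (h a) \<noteq> (snd (h b) \<noteq> f a b))" if "a \<in> C" "b \<in> C" for a b
      using hmult[OF that] fst[OF that(1)] fst[OF that(2)]
      by (auto simp: H_def split: prod.splits)
  qed
qed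

text \<open>The fibres of p form a congruence on the loop; a finite quotient is thus handled as a
  map with finite image.\<close>

definition compatible :: "('a loop_term set \<Rightarrow> 'q) \<Rightarrow> bool" where
  "compatible p \<longleftrightarrow> (\<forall>a\<in>C. \<forall>b\<in>C. \<forall>a'\<in>C. \<forall>b'\<in>C.
    p a = p a' \<longrightarrow> p b = p b' \<longrightarrow> p (a \<cdot> b) = p (a' \<cdot> b'))"

lemma compatibleD:
  "\<lbrakk>compatible p; p a = p a'; p b = p b'; a \<in> C; b \<in> C; a' \<in> C; b' \<in> C\<rbrakk> \<Longrightarrow> p (a \<cdot> b) = p (a' \<cdot> b')"
  unfolding compatible_def by blast

definition subterm_closed :: "'a loop_term set set \<Rightarrow> bool" where
  "subterm_closed P \<longleftrightarrow> P \<subseteq> C \<and> e \<in> P \<and> (\<forall>u\<in>P. u \<noteq> e \<longrightarrow> u \<notin> gens \<longrightarrow>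
    (\<exists>a\<in>P. \<exists>b\<in>P. a \<noteq> e \<and> b \<noteq> e \<and> u = a \<cdot> b \<and> len u = len a + len b))"

text \<open>The cocycle is the indicator of the image under \<open>p\<close> of the line through \<open>c\<close> and its factors.
  Since \<open>p\<close> is injective on \<open>P\<close>, no line inside \<open>P\<close> has the same image, so the new bit vanishes
  on \<open>P\<close> but not at \<open>c\<close>.\<close>

lemma separating_bit:
  assumes P: "subterm_closed P" and p: "compatible p" "inj_on p P"
    and c: "c \<in> C" "c \<notin> P" "p c \<in> p ` P"
    and c_dec: "c \<in> gens \<or> (\<exists>a\<in>P. \<exists>b\<in>P. c = a \<cdot> b)"
  obtains z :: "'a loop_term set \<Rightarrow> bool"
  where "compatible (\<lambda>u. z u # p u)" "z c" "\<And>u. u \<in> P \<Longrightarrow> \<not> z u"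
proof -
  have PC: "P \<subseteq> C" and eP: "e \<in> P" using P by (auto simp: subterm_closed_def)
  obtain q where q: "q \<in> P" "p q = p c" using c by auto
  obtain f v where f_comm: "\<And>a b. \<lbrakk>a \<in> C; b \<in> C\<rbrakk> \<Longrightarrow> f a b = f b a"
    and f_sq: "\<And>a. a \<in> C \<Longrightarrow> \<not> f a a" and f_one: "\<And>a. a \<in> C \<Longrightarrow> \<not> f e a"
    and f_line: "\<And>a b. \<lbrakk>a \<in> C; b \<in> C\<rbrakk> \<Longrightarrow> f a (a \<cdot> b) = f a b"
    and f_p: "\<And>a b a' b'. \<lbrakk>p a = p a'; p b = p b'; a \<in> C; b \<in> C; a' \<in> C; b' \<in> C\<rbrakk>
      \<Longrightarrow> f a b = f a' b'"
    and v: "\<And>u. u \<in> P \<Longrightarrow> u \<in> gens \<Longrightarrow> \<not> v u"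
    and f_P: "\<And>a b. \<lbrakk>a \<in> P; b \<in> P; a \<cdot> b \<in> P\<rbrakk> \<Longrightarrow> \<not> f a b"
    and c_cases: "c \<in> gens \<and> v c \<or> (\<exists>a\<in>P. \<exists>b\<in>P. c = a \<cdot> b \<and> f a b)"
  proof (cases "c \<in> gens")
    case True
    \<comment> \<open>For a generator the trivial cocycle suffices: the new bit is a homomorphism,
      true at c and false at the other generators.\<close>
    show ?thesis by (rule that[of "\<lambda>_ _. False" "\<lambda>u. u = c"]) (use True c in auto)
  next
    case False
    with c_dec obtain a b where ab: "a \<in> P" "b \<in> P" "c = a \<cdot> b" by blast
    then have abC: "a \<in> C" "b \<in> C" using PC by auto
    have "a \<noteq> b" "a \<noteq> e" "b \<noteq> e" using ab abC c eP F.square by auto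
    then have pab: "p a \<noteq> p b" "p a \<noteq> p e" "p b \<noteq> p e"
      using ab eP p(2) by (auto simp: inj_on_def)
    \<comment> \<open>The image of the line is nondegenerate: p c = p a would give p b = p e,
      against injectivity on P.\<close>
    have "p c \<noteq> p a"
    proof
      assume "p c = p a"
      then have "p (a \<cdot> c) = p (a \<cdot> a)" using compatibleD[OF p(1)] abC c by blast
      then show False using pab ab abC by (simp add: F.left_inverse F.square)
    qed
    moreover have "p c \<noteq> p b"
    proof
      assume "p c = p b"
      then have "p (b \<cdot> c) = p (b \<cdot> b)" using compatibleD[OF p(1)] abC c by blast
      then show False using pab ab abC F.m_comm[of a b] by (simp add: F.left_inverse F.square)
    qed
    ultimately have card3: "card {p a, p b, p c} = 3" using pab by auto
    have degenerate: "{x, y, w} \<noteq> {p a, p b, p c}" if "x = y \<or> x = w \<or> y = w" for x y w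
    proof -
      have "card {x, y, w} \<le> 2"
        using that by (auto simp: card_insert_if)
      then show ?thesis using card3 by fastforce
    qed
    define f where "f x y \<longleftrightarrow> {p x, p y, p (x \<cdot> y)} = {p a, p b, p c}" for x y
    show ?thesis
    proof (rule that[of f "\<lambda>_. False"])
      show "f x y = f y x" if "x \<in> C" "y \<in> C" for x y
        using F.m_comm[OF that] by (simp add: f_def insert_commute)
      show "\<not> f x x" "\<not> f e x" if "x \<in> C" for x
        using degenerate that by (auto simp: f_def)
      show "f x (x \<cdot> y) = f x y" if "x \<in> C" "y \<in> C" for x y
        using that by (simp add: f_def F.left_inverse insert_commute)
      show "f x y = f x' y'"
        if "p x = p x'" "p y = p y'" "x \<in> C" "y \<in> C" "x' \<in> C" "y' \<in> C" for x y x' y'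
        using compatibleD[OF p(1) that] that by (simp add: f_def)
      show "\<not> f x y" if "x \<in> P" "y \<in> P" "x \<cdot> y \<in> P" for x y
      proof
        assume "f x y"
        then have "p ` {x, y, x \<cdot> y} = p ` {a, b, q}" using q by (simp add: f_def)
        \<comment> \<open>Injectivity turns equality of images into equality of lines, so ab = q
          lies in P, whereas ab = c does not.\<close>
        then have eq: "{x, y, x \<cdot> y} = {a, b, q}"
          using inj_on_image_eq_iff[OF p(2)] that ab q by (metis empty_subsetI insert_subset)
        have xy: "x \<in> C" "y \<in> C" using that PC by auto
        note lines = mult_cancel[OF xy] F.m_comm[OF xy(2,1)]
        have mem: "a \<in> {x, y, x \<cdot> y}" "b \<in> {x, y, x \<cdot> y}" "q \<in> {x, y, x \<cdot> y}"
          unfolding eq by auto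
        have "q \<noteq> a" "q \<noteq> b" using \<open>p c \<noteq> p a\<close> \<open>p c \<noteq> p b\<close> q by auto
        with mem \<open>a \<noteq> b\<close> lines have "a \<cdot> b = q" by (elim insertE emptyE) simp_all
        then show False using q c ab by simp
      qed
      show "c \<in> gens \<and> False \<or> (\<exists>a\<in>P. \<exists>b\<in>P. c = a \<cdot> b \<and> f a b)"
        using ab by (auto simp: f_def)
    qed auto
  qed
  obtain z where z_gen: "\<And>x. x \<in> gens \<Longrightarrow> z x = v x"
    and z_mult: "\<And>a b. \<lbrakk>a \<in> C; b \<in> C\<rbrakk> \<Longrightarrow> z (a \<cdot> b) = (z a \<noteq> (z b \<noteq> f a b))"
    using twisted_hom_exists[of f v, OF f_comm f_sq f_one f_line] by blast
  have zP: "\<not> z u" if "u \<in> P" for u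
    using that
  proof (induction "len u" arbitrary: u rule: less_induct)
    case less
    consider "u = e" | "u \<in> gens" | a b where "a \<in> P" "b \<in> P" "a \<noteq> e" "b \<noteq> e" "u = a \<cdot> b"
      "len u = len a + len b"
      using P less.prems unfolding subterm_closed_def by blast
    then show ?case
    proof cases
      case 1
      then show ?thesis using z_mult[of e e] f_one[of e] by simp
    next
      case 2
      then show ?thesis using z_gen v less.prems by simp
    next
      case 3
      then have "len a > 0" "len b > 0" using len_eq_0_iff PC by auto
      then show ?thesis
        using 3 less.hyps[of a] less.hyps[of b] z_mult[of a b] f_P[of a b] PC less.prems by auto
    qed
  qed
  moreover have "z c" using c_cases z_gen z_mult zP PC by blast
  moreover have "compatible (\<lambda>u. z u # p u)"
    unfolding compatible_def
  proof (intro ballI impI)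
    fix a b a' b' assume C: "a \<in> C" "b \<in> C" "a' \<in> C" "b' \<in> C"
      and "z a # p a = z a' # p a'" "z b # p b = z b' # p b'"
    then have "z a = z a'" "z b = z b'" "p a = p a'" "p b = p b'" by auto
    with C show "z (a \<cdot> b) # p (a \<cdot> b) = z (a' \<cdot> b') # p (a' \<cdot> b')"
      using compatibleD[OF p(1), of a a' b b'] f_p[of a a' b b'] by (simp add: z_mult)
  qed
  ultimately show ?thesis using that by blast
qed

text \<open>Delete a longest point c of P: a map separating the rest either separates c too or
  receives one more bit. Lists let the number of bits grow.\<close>

lemma residually_finite:
  assumes "finite P" "subterm_closed P"
  shows "\<exists>p :: 'a loop_term set \<Rightarrow> bool list. compatible p \<and> finite (p ` C) \<and> inj_on p P"
  using assms
proof (induction "card P" arbitrary: P rule: less_induct)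
  case less
  have PC: "P \<subseteq> C" and eP: "e \<in> P" using less.prems by (auto simp: subterm_closed_def)
  show ?case
  proof (cases "P = {e}")
    case True
    have "compatible (\<lambda>_. [] :: bool list)" "inj_on (\<lambda>_. [] :: bool list) P"
      using True by (auto simp: compatible_def)
    moreover have "finite ((\<lambda>_. [] :: bool list) ` C)"
      by (rule finite_subset[of _ "{[]}"]) auto
    ultimately show ?thesis by blast
  next
    case False
    have "Max (len ` P) \<in> len ` P" using less.prems eP by (intro Max_in) auto
    then obtain c where c: "c \<in> P" "len c = Max (len ` P)" by auto
    have c_max: "len u \<le> len c" if "u \<in> P" for u
      using that less.prems c by simp
    obtain u where "u \<in> P" "u \<noteq> e" using False eP by auto
    then have "len u > 0" using len_eq_0_iff PC by auto
    then have "c \<noteq> e" using c_max[OF \<open>u \<in> P\<close>] by auto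
    define Q where "Q = P - {c}"
    \<comment> \<open>Both factors are shorter than c, so they stay in \<open>Q\<close>, and
      \<open>Q\<close> inherits subterm closure.\<close>
    have dec: "\<exists>a\<in>Q. \<exists>b\<in>Q. a \<noteq> e \<and> b \<noteq> e \<and> u = a \<cdot> b \<and> len u = len a + len b"
      if u: "u \<in> P" "u \<noteq> e" "u \<notin> gens" for u
    proof -
      obtain a b where ab: "a \<in> P" "b \<in> P" "a \<noteq> e" "b \<noteq> e" "u = a \<cdot> b" "len u = len a + len b"
        using less.prems(2) u unfolding subterm_closed_def by blast
      then have "len a > 0" "len b > 0" using len_eq_0_iff PC by auto
      then have "len a < len c" "len b < len c" using ab c_max[OF u(1)] by auto
      with ab show ?thesis unfolding Q_def by blast
    qed
    have Q: "subterm_closed Q" "finite Q"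
      using dec PC eP \<open>c \<noteq> e\<close> less.prems by (auto simp: subterm_closed_def Q_def)
    have "card Q < card P" using c less.prems unfolding Q_def by (intro card_Diff1_less)
    from less.hyps[OF this Q(2,1)] obtain p :: "'a loop_term set \<Rightarrow> bool list" where
      p: "compatible p" "finite (p ` C)" "inj_on p Q" by blast
    have P_eq: "P = insert c Q" and cQ: "c \<notin> Q" using c by (auto simp: Q_def)
    show ?thesis
    proof (cases "p c \<in> p ` Q")
      case False
      then have "inj_on p P" using p cQ by (simp add: P_eq)
      with p show ?thesis by blast
    next
      case True
      have "c \<in> gens \<or> (\<exists>a\<in>Q. \<exists>b\<in>Q. c = a \<cdot> b)" using dec[OF c(1) \<open>c \<noteq> e\<close>] by blast
      then obtain z :: "'a loop_term set \<Rightarrow> bool"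
        where z: "compatible (\<lambda>u. z u # p u)" "z c" "\<And>u. u \<in> Q \<Longrightarrow> \<not> z u"
        using separating_bit[OF Q(1) p(1,3) _ cQ True] c PC by blast
      have "(\<lambda>u. z u # p u) ` C \<subseteq> (\<lambda>(b, l). b # l) ` (UNIV \<times> p ` C)" by auto
      then have "finite ((\<lambda>u. z u # p u) ` C)" by (rule finite_subset) (use p in auto)
      moreover have "inj_on (\<lambda>u. z u # p u) P"
        using p(3) z(2,3) by (auto simp: inj_on_def P_eq)
      ultimately show ?thesis using z(1) by blast
    qed
  qed
qed

lemma subterm_closed_ball: "subterm_closed {u \<in> C. len u \<le> n}"
  unfolding subterm_closed_def
proof (intro conjI ballI impI)
  fix u assume u: "u \<in> {u \<in> C. len u \<le> n}" "u \<noteq> e" "u \<notin> gens"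
  then obtain a b where "a \<in> C" "b \<in> C" "a \<noteq> e" "b \<noteq> e" "u = a \<cdot> b"
    "len (a \<cdot> b) = len a + len b"
    using decompose by blast
  with u show "\<exists>a\<in>{u \<in> C. len u \<le> n}. \<exists>b\<in>{u \<in> C. len u \<le> n}.
      a \<noteq> e \<and> b \<noteq> e \<and> u = a \<cdot> b \<and> len u = len a + len b"
    by (intro bexI[of _ a] bexI[of _ b]) auto
qed auto

section \<open>The fully invariant set killed by a finite quotient\<close>

text \<open>For compatible p, every homomorphism into the quotient by p lifts to an endomorphism,
  since the loop is free. Ranging over endomorphisms therefore gives the common kernel of all
  homomorphisms to that quotient.\<close>

definition hom_kernel :: "('a loop_term set \<Rightarrow> 'q) \<Rightarrow> 'a loop_term set set" where
  "hom_kernel p = {u \<in> C. \<forall>g\<in>hom F F. p (g u) = p e}"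

lemma hom_kernel_hom:
  assumes "u \<in> hom_kernel p" "g \<in> hom F F"
  shows "g u \<in> hom_kernel p"
proof -
  have "p (h (g u)) = p e" if "h \<in> hom F F" for h
  proof -
    have "h \<circ> g \<in> hom F F" using that assms(2) by (auto simp: hom_def Pi_iff)
    then have "p ((h \<circ> g) u) = p e" using assms(1) unfolding hom_kernel_def by blast
    then show ?thesis by simp
  qed
  then show ?thesis using assms hom_closed by (auto simp: hom_kernel_def)
qed

text \<open>Pigeonhole: there are finitely many maps p after g, so two elements of S have equal
  values under all of them, and each of these maps kills their product.\<close>

lemma hom_kernel_meets_infinite:
  assumes X: "finite X" and p: "compatible p" "finite (p ` C)" and S: "infinite S" "S \<subseteq> C"
  obtains u v where "u \<in> S" "v \<in> S" "u \<noteq> v" "u \<cdot> v \<in> hom_kernel p"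
proof -
  define \<Phi> where "\<Phi> = (\<lambda>g. restrict (\<lambda>u. p (g u)) C) ` hom F F"
  have agree: "p (g u) = p (h u)"
    if "g \<in> hom F F" "h \<in> hom F F" "\<And>x. x \<in> gens \<Longrightarrow> p (g x) = p (h x)" "u \<in> C" for g h u
    using that(4)
  proof (induction rule: carrier_induct)
    case (mult a b)
    then show ?case
      using compatibleD[OF p(1), of "g a" "h a" "g b" "h b"] hom_closed[OF that(1)]
        hom_closed[OF that(2)] hom_mult[OF that(1)] hom_mult[OF that(2)] by simp
  qed (use that hom_one[OF that(1)] hom_one[OF that(2)] in auto)
  \<comment> \<open>By compatibility, p after g depends only on its values on the finitely many
    generators.\<close>
  have "inj_on (\<lambda>\<phi>. restrict \<phi> gens) \<Phi>"
  proof (rule inj_onI)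
    fix \<phi> \<psi> assume "\<phi> \<in> \<Phi>" "\<psi> \<in> \<Phi>" and eq: "restrict \<phi> gens = restrict \<psi> gens"
    then obtain g h where gh: "g \<in> hom F F" "h \<in> hom F F"
      "\<phi> = restrict (\<lambda>u. p (g u)) C" "\<psi> = restrict (\<lambda>u. p (h u)) C" by (auto simp: \<Phi>_def)
    have "p (g x) = p (h x)" if "x \<in> gens" for x
      using fun_cong[OF eq, of x] gh that gens_carrier by auto
    then have "p (g u) = p (h u)" if "u \<in> C" for u using agree gh that by blast
    then show "\<phi> = \<psi>" unfolding gh by (auto intro: restrict_ext)
  qed
  moreover have "(\<lambda>\<phi>. restrict \<phi> gens) ` \<Phi> \<subseteq> gens \<rightarrow>\<^sub>E p ` C"
    using gens_carrier hom_closed by (auto simp: \<Phi>_def)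
  moreover have "finite (gens \<rightarrow>\<^sub>E p ` C)" using X p by (intro finite_PiE) auto
  ultimately have "finite \<Phi>" by (meson finite_imageD finite_subset)
  then have fin: "finite (\<Phi> \<rightarrow>\<^sub>E p ` C)" using p by (intro finite_PiE) auto
  define ev where "ev u = restrict (\<lambda>\<phi>. \<phi> u) \<Phi>" for u
  have "ev ` S \<subseteq> \<Phi> \<rightarrow>\<^sub>E p ` C"
    using S hom_closed by (auto simp: \<Phi>_def ev_def)
  then have "\<not> inj_on ev S" using fin S by (meson finite_imageD finite_subset)
  then obtain u v where uv: "u \<in> S" "v \<in> S" "u \<noteq> v" "ev u = ev v" by (auto simp: inj_on_def)
  have C: "u \<in> C" "v \<in> C" using uv S by auto
  have "p (g (u \<cdot> v)) = p e" if g: "g \<in> hom F F" for g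
  proof -
    have "restrict (\<lambda>u. p (g u)) C \<in> \<Phi>" using g by (auto simp: \<Phi>_def)
    then have "p (g u) = p (g v)"
      using fun_cong[OF uv(4), of "restrict (\<lambda>u. p (g u)) C"] C by (simp add: ev_def)
    then have "p (g u \<cdot> g v) = p (g v \<cdot> g v)"
      using compatibleD[OF p(1)] C g hom_closed by blast
    then show ?thesis using C g by (simp add: hom_mult F.square hom_closed)
  qed
  then have "u \<cdot> v \<in> hom_kernel p" using C by (simp add: hom_kernel_def)
  with uv show ?thesis using that by blast
qed

text \<open>Multiplying u by a generator y other than u lengthens u unless y is a factor of u. As u
  has at most two factors, one of three generators always works.\<close>

lemma infinite_if_three_gens:
  assumes gens: "a \<in> gens" "b \<in> gens" "c \<in> gens" "a \<noteq> b" "a \<noteq> c" "b \<noteq> c"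
    and S: "a \<in> S" "b \<in> S" "c \<in> S" "S \<subseteq> C" "\<And>u v. \<lbrakk>u \<in> S; v \<in> S\<rbrakk> \<Longrightarrow> u \<cdot> v \<in> S"
  shows "infinite S"
proof -
  have "\<exists>u\<in>S. len u = Suc k" for k
  proof (induction k)
    case 0
    have "len a = Suc 0" using len_gen[OF gens(1)] by simp
    with S(1) show ?case by blast
  next
    case (Suc k)
    then obtain u where u: "u \<in> S" "len u = Suc k" by blast
    then have uC: "u \<in> C" "u \<noteq> e" using S by auto
    have "\<exists>y\<in>{a, b, c}. len (u \<cdot> y) = Suc (Suc k)"
    proof (rule ccontr)
      assume no: "\<not> (\<exists>y\<in>{a, b, c}. len (u \<cdot> y) = Suc (Suc k))"
      have child: "u \<cdot> y \<in> C \<and> u \<cdot> y \<noteq> e \<and> y \<in> C \<and> y \<noteq> e \<and> len u = len y + len (u \<cdot> y)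
          \<and> y \<cdot> (u \<cdot> y) = u"
        if y: "y \<in> {a, b, c}" "y \<noteq> u" for y
      proof -
        have yg: "y \<in> C" "len y = 1" using y gens gens_carrier len_gen by auto
        then have "y \<noteq> e" by auto
        moreover have uy: "u \<cdot> y \<in> C" "u \<cdot> y \<noteq> e"
          using y uC yg mult_eq_one_iff[of u y] by auto
        moreover have "len (u \<cdot> y) > 0" using uy len_eq_0_iff by auto
        ultimately show ?thesis
          using len_mult_cases[of u y] uC yg y u no F.left_inverse[of y u] F.m_comm[of y u] by auto
      qed
      have len1: "len y = 1" if "y \<in> {a, b, c}" for y using that gens len_gen by blast
      obtain y where y: "y \<in> {a, b, c}" "y \<noteq> u" using gens(4) by (metis insertI1 insertI2)
      then have "len (u \<cdot> y) > 0" using child[OF y] len_eq_0_iff[of "u \<cdot> y"] by simp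
      then have "len u \<noteq> 1" using child[OF y] len1[OF y(1)] by linarith
      then have "y \<noteq> u" if "y \<in> {a, b, c}" for y using len1[OF that] by metis
      then have ch: "y \<in> {a, b, c} \<Longrightarrow> y' \<in> {a, b, c} \<Longrightarrow> y = y' \<or> y = u \<cdot> y'" for y y'
        using reduced_unique[of y "u \<cdot> y" y' "u \<cdot> y'"] child[of y] child[of y'] by metis
      \<comment> \<open>Both a and c would be the cofactor of b in u, hence equal.\<close>
      then show False using ch[of a b] ch[of c b] gens(4-6) by (metis insertI1 insertI2)
    qed
    then show ?case using u S by blast
  qed
  then have "Suc k \<in> len ` S" for k by (metis image_eqI)
  then have "range Suc \<subseteq> len ` S" by blast
  moreover have "infinite (range Suc)" by (simp add: finite_image_iff)
  ultimately show ?thesis using finite_surj by blast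
qed

section \<open>Automorphisms and tops of lines\<close>

text \<open>The top of a line is the point whose length is the sum of the other two, so for
  automorphisms the equation says that tops go to tops.\<close>

definition preserves_top ::
    "'a loop_term set set \<Rightarrow> ('a loop_term set \<Rightarrow> 'a loop_term set) \<Rightarrow> bool" where
  "preserves_top K g \<longleftrightarrow> (\<forall>a\<in>C. \<forall>b\<in>C. a \<in> K \<or> b \<in> K \<or> a \<cdot> b \<in> K \<longrightarrow>
    len (a \<cdot> b) = len a + len b \<longrightarrow> len (g (a \<cdot> b)) = len (g a) + len (g b))"

lemma preserves_topD:
  assumes "preserves_top K g" "a \<in> C" "b \<in> C" "a \<in> K \<or> b \<in> K \<or> a \<cdot> b \<in> K"
    "len (a \<cdot> b) = len a + len b"
  shows "len (g (a \<cdot> b)) = len (g a) + len (g b)"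
  using assms unfolding preserves_top_def by blast

lemma preserves_top_comp:
  assumes g: "preserves_top K g" and h: "h \<in> hom F F" "preserves_top K h"
    and K: "\<And>u. u \<in> K \<Longrightarrow> h u \<in> K"
  shows "preserves_top K (compose C g h)"
  unfolding preserves_top_def
proof (intro ballI impI)
  fix a b assume ab: "a \<in> C" "b \<in> C" "a \<in> K \<or> b \<in> K \<or> a \<cdot> b \<in> K" "len (a \<cdot> b) = len a + len b"
  have hm: "h (a \<cdot> b) = h a \<cdot> h b" using ab h(1) by (simp add: hom_mult)
  have "len (h a \<cdot> h b) = len (h a) + len (h b)" using preserves_topD[OF h(2) ab] hm by simp
  moreover have "h a \<in> K \<or> h b \<in> K \<or> h a \<cdot> h b \<in> K" using ab(3) K hm by metis
  ultimately have "len (g (h a \<cdot> h b)) = len (g (h a)) + len (g (h b))"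
    using preserves_topD[OF g, of "h a" "h b"] ab hom_closed[OF h(1)] by blast
  then show "len (compose C g h (a \<cdot> b)) = len (compose C g h a) + len (compose C g h b)"
    using ab hm by (simp add: compose_def)
qed

text \<open>If g sent the top elsewhere, h would carry the wrong top back to a or b, although ab is
  the only top of its line.\<close>

lemma preserves_top_inverse:
  assumes h: "h \<in> hom F F" "preserves_top K h"
    and g: "g \<in> hom F F" "\<And>u. u \<in> C \<Longrightarrow> h (g u) = u" and K: "\<And>u. u \<in> K \<Longrightarrow> g u \<in> K"
  shows "preserves_top K g"
  unfolding preserves_top_def
proof (intro ballI impI)
  fix a b assume ab: "a \<in> C" "b \<in> C" "a \<in> K \<or> b \<in> K \<or> a \<cdot> b \<in> K" "len (a \<cdot> b) = len a + len b"
  have gm: "g (a \<cdot> b) = g a \<cdot> g b" using ab g(1) by (simp add: hom_mult)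
  have gC: "g a \<in> C" "g b \<in> C" using ab g(1) hom_closed by auto
  have gK: "g a \<in> K \<or> g b \<in> K \<or> g a \<cdot> g b \<in> K" using ab(3) K gm by metis
  show "len (g (a \<cdot> b)) = len (g a) + len (g b)"
  proof (cases "a = e \<or> b = e")
    case True
    then show ?thesis using ab hom_one[OF g(1)] by auto
  next
    case False
    then have pos: "len a > 0" "len b > 0" using ab len_eq_0_iff by auto
    have ne: "g a \<noteq> e" "g b \<noteq> e" using False g(2) ab hom_one[OF h(1)] by metis+
    have "a \<noteq> b" using pos ab F.square by fastforce
    then have "g a \<noteq> g b" using g(2) ab by metis
    note cases = len_mult_cases[OF gC ne this]
    have hg: "h (g a) = a" "h (g b) = b" "h (g a \<cdot> g b) = a \<cdot> b"
      using g(2) ab gm by (metis F.m_closed)+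
    have False if "len (g b) = len (g a) + len (g a \<cdot> g b)"
    proof -
      have "len b = len a + len (a \<cdot> b)"
        using preserves_topD[OF h(2), of "g a" "g a \<cdot> g b"] gC gK that hg
        by (simp add: F.left_inverse disj_ac)
      then show False using ab pos by simp
    qed
    moreover have False if "len (g a) = len (g b) + len (g a \<cdot> g b)"
    proof -
      have "len a = len b + len (a \<cdot> b)"
        using preserves_topD[OF h(2), of "g b" "g a \<cdot> g b"] gC gK that hg
        by (simp add: mult_cancel disj_ac)
      then show False using ab pos by simp
    qed
    ultimately show ?thesis using cases gm by auto
  qed
qed

lemma auto_homD: "g \<in> auto F \<Longrightarrow> g \<in> hom F F"
  and auto_injD: "g \<in> auto F \<Longrightarrow> inj_on g C"
  by (auto simp: auto_def Bij_def bij_betw_def)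

text \<open>Invariance of K keeps the images of lines meeting K among such lines, so the condition
  survives composition and inversion.\<close>

lemma preserves_top_generate:
  assumes A: "A \<subseteq> auto F" "\<And>g. g \<in> A \<Longrightarrow> preserves_top K g"
    and K: "\<And>g u. \<lbrakk>g \<in> hom F F; u \<in> K\<rbrakk> \<Longrightarrow> g u \<in> K"
    and "g \<in> generate (AutoGroup F) A"
  shows "preserves_top K g"
proof -
  interpret Aut: group "AutoGroup F" by (rule F.AutoGroup)
  have carr: "carrier (AutoGroup F) = auto F" by (simp add: AutoGroup_def)
  have mult: "g \<otimes>\<^bsub>AutoGroup F\<^esub> h = compose C g h" if "g \<in> auto F" "h \<in> auto F" for g h
    using that by (simp add: AutoGroup_def BijGroup_def auto_def)
  have Aut_one: "\<one>\<^bsub>AutoGroup F\<^esub> = (\<lambda>u\<in>C. u)" by (simp add: AutoGroup_def BijGroup_def)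
  have "g \<in> auto F \<and> preserves_top K g"
    using assms(4)
  proof (induction rule: generate.induct)
    case one
    have "preserves_top K \<one>\<^bsub>AutoGroup F\<^esub>"
      unfolding Aut_one preserves_top_def by simp
    then show ?case using Aut.one_closed unfolding carr by blast
  next
    case (incl h)
    then show ?case using A by auto
  next
    case (inv h)
    then have h: "h \<in> auto F" "preserves_top K h" using A by auto
    let ?g = "inv\<^bsub>AutoGroup F\<^esub> h"
    have g: "?g \<in> auto F" using Aut.inv_closed h by (simp add: carr)
    have "compose C h ?g = (\<lambda>u\<in>C. u)"
      using Aut.r_inv[of h] h g by (simp add: carr Aut_one mult)
    then have "h (?g u) = u" if "u \<in> C" for u
      using that by (metis compose_eq restrict_apply')
    then show ?case
      using preserves_top_inverse[OF auto_homD[OF h(1)] h(2) auto_homD[OF g]] K auto_homD[OF g] g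
      by blast
  next
    case (eng h1 h2)
    then show ?case
      using preserves_top_comp[of K h1 h2] K auto_homD[of h2] mult[of h1 h2]
        Aut.m_closed[of h1 h2] by (simp add: carr)
  qed
  then show ?thesis by simp
qed

text \<open>A misplaced top forces the image of the line into the ball of radius M. There p
  separates points, so a kernel point on the line would be sent to e, against injectivity of
  g.\<close>

lemma preserves_top_if_separated:
  assumes g: "g \<in> auto F" and gen: "\<And>x. x \<in> gens \<Longrightarrow> len (g x) \<le> M"
    and p: "inj_on p {u \<in> C. len u \<le> M}"
  shows "preserves_top (hom_kernel p) g"
  unfolding preserves_top_def
proof (intro ballI impI, rule ccontr)
  fix a b assume ab: "a \<in> C" "b \<in> C" "a \<in> hom_kernel p \<or> b \<in> hom_kernel p \<or> a \<cdot> b \<in> hom_kernel p"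
    "len (a \<cdot> b) = len a + len b" and bad: "len (g (a \<cdot> b)) \<noteq> len (g a) + len (g b)"
  have gh: "g \<in> hom F F" "inj_on g C" using g auto_homD auto_injD by auto
  have gm: "g (a \<cdot> b) = g a \<cdot> g b" using ab gh by (simp add: hom_mult)
  have nab: "a \<noteq> e" "b \<noteq> e" using bad ab hom_one[OF gh(1)] by auto
  then have "len a > 0" using ab len_eq_0_iff by auto
  then have "a \<noteq> b" using ab F.square by fastforce
  then have abne: "a \<cdot> b \<noteq> e" using ab mult_eq_one_iff by auto
  have ne: "g u \<noteq> e" if "u \<in> C" "u \<noteq> e" for u
    using that inj_onD[OF gh(2), of u e] hom_one[OF gh(1)] by auto
  have "g a \<noteq> g b" using \<open>a \<noteq> b\<close> ab inj_onD[OF gh(2)] by metis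
  then consider "len (g b) = len (g a) + len (g (a \<cdot> b))" | "len (g a) = len (g b) + len (g (a \<cdot> b))"
    using len_mult_cases[of "g a" "g b"] ne ab nab hom_closed[OF gh(1)] bad gm by metis
  \<comment> \<open>\<open>cancelled_image_bound\<close> bounds the longest image point; the other
    two are no longer.\<close>
  then have "len (g a) \<le> M \<and> len (g b) \<le> M \<and> len (g (a \<cdot> b)) \<le> M"
  proof cases
    case 1
    then have "len (g b) \<le> M"
      using cancelled_image_bound[OF gh gen ab(2,1) nab(2,1)] ab(4) F.m_comm[OF ab(1,2)] by simp
    with 1 show ?thesis by simp
  next
    case 2
    then have "len (g a) \<le> M"
      using cancelled_image_bound[OF gh gen ab(1,2) nab] ab(4) by simp
    with 2 show ?thesis by simp
  qed
  then have *: "u \<in> {a, b, a \<cdot> b} \<Longrightarrow> len (g u) \<le> M" for u by auto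
  have False if u: "u \<in> {a, b, a \<cdot> b}" "u \<in> hom_kernel p" for u
  proof -
    have uC: "u \<in> C" "u \<noteq> e" using u ab nab abne by auto
    have "p (g u) = p e" using u gh by (simp add: hom_kernel_def)
    then have "g u = e"
      using inj_onD[OF p, of "g u" e] *[OF u(1)] hom_closed[OF gh(1) uC(1)] by simp
    then show False using ne uC by blast
  qed
  then show False using ab(3) by blast
qed

section \<open>An automorphism that moves the top of a line meeting the kernel\<close>

theorem AutoGroup_not_finitely_generated:
  assumes X: "finite X" "card X > 3"
  shows "\<not> finitely_generated_group (AutoGroup F)"
proof
  assume "finitely_generated_group (AutoGroup F)"
  then obtain A where A: "finite A" "A \<subseteq> auto F" "generate (AutoGroup F) A = auto F"
    by (auto simp: finitely_generated_group_def AutoGroup_def)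
  have "finite ((\<lambda>(g, x). len (g x)) ` (A \<times> gens))" using A X by auto
  \<comment> \<open>M bounds the lengths of all images of generators under the finitely many
    automorphisms in \<open>A\<close>; p then separates the ball of radius M.\<close>
  then obtain M where "\<forall>n\<in>(\<lambda>(g, x). len (g x)) ` (A \<times> gens). n \<le> M"
    using finite_nat_set_iff_bounded_le by blast
  then have M: "len (g x) \<le> M" if "g \<in> A" "x \<in> gens" for g x using that by auto
  obtain p :: "'a loop_term set \<Rightarrow> bool list" where
    p: "compatible p" "finite (p ` C)" "inj_on p {u \<in> C. len u \<le> M}"
    using residually_finite[OF finite_ball[OF X(1)] subterm_closed_ball] by blast
  have pres: "preserves_top (hom_kernel p) g" if "g \<in> auto F" for g
  proof (rule preserves_top_generate)
    show "preserves_top (hom_kernel p) g" if "g \<in> A" for g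
      using preserves_top_if_separated[OF _ _ p(3)] M A that by blast
  qed (use A that hom_kernel_hom in auto)

  \<comment> \<open>One generator x is to be moved; three others supply infinitely many elements
    that avoid x.\<close>
  have "card gens = card X" by (simp add: card_image inj_on_free_gen)
  moreover obtain xs where xs: "set xs = gens" "distinct xs"
    using finite_distinct_list[of gens] X(1) by auto
  ultimately have "4 \<le> length xs" using X(2) distinct_card by fastforce
  then obtain x a b c ys where "xs = x # a # b # c # ys"
    by (auto simp: numeral_eq_Suc Suc_le_length_iff)
  with xs have T: "x \<in> gens" "a \<in> gens" "b \<in> gens" "c \<in> gens"
    "x \<noteq> a" "x \<noteq> b" "x \<noteq> c" "a \<noteq> b" "a \<noteq> c" "b \<noteq> c"
    by (metis distinct_length_2_or_more list.set_intros)+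
  have xC: "x \<in> C" using T gens_carrier by auto
  \<comment> \<open>The map \<kappa> deletes x; its fixed points are the elements that do not
    involve x.\<close>
  have "(\<lambda>y. if y = x then e else y) \<in> gens \<rightarrow> C" using gens_carrier by auto
  then obtain \<kappa> where \<kappa>: "\<kappa> \<in> hom F F" "\<And>y. y \<in> gens \<Longrightarrow> \<kappa> y = (if y = x then e else y)"
    using hom_extend by blast
  define S where "S = {u \<in> C. \<kappa> u = u}"
  have S_mult: "u \<cdot> v \<in> S" if "u \<in> S" "v \<in> S" for u v
    using that \<kappa>(1) by (simp add: S_def hom_mult)
  have S_gens: "y \<in> S" if "y \<in> gens" "x \<noteq> y" for y
    using that \<kappa>(2)[of y] gens_carrier by (auto simp: S_def)
  have "S \<subseteq> C" unfolding S_def by blast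
  then have "infinite S"
    using infinite_if_three_gens[OF T(2,3,4,8,9,10)] S_gens T S_mult by blast
  then obtain u v where uv: "u \<in> S" "v \<in> S" "u \<noteq> v" "u \<cdot> v \<in> hom_kernel p"
    using hom_kernel_meets_infinite[OF X(1) p(1,2)] S_def by blast
  define w where "w = u \<cdot> v"
  have wS: "w \<in> S" using S_mult uv by (simp add: w_def)
  then have w: "w \<in> C" "\<kappa> w = w" "w \<in> hom_kernel p" using uv by (auto simp: S_def w_def)
  have "w \<noteq> e" using uv mult_eq_one_iff by (auto simp: w_def S_def)
  have "(\<lambda>y. if y = x then x \<cdot> w else y) \<in> gens \<rightarrow> C" using gens_carrier xC w by auto
  then obtain \<phi> where \<phi>: "\<phi> \<in> hom F F" "\<And>y. y \<in> gens \<Longrightarrow> \<phi> y = (if y = x then x \<cdot> w else y)"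
    using hom_extend by blast
  have \<phi>x: "\<phi> x = x \<cdot> w" using \<phi>(2) T(1) by simp
  \<comment> \<open>On generators \<phi> moves only x, which \<kappa> deletes; so \<phi> after
    \<kappa> agrees with \<kappa>, and \<phi> fixes w. This makes \<phi> an involution.\<close>
  have "\<phi> \<circ> \<kappa> \<in> hom F F" using \<phi> \<kappa> by (auto simp: hom_def Pi_iff)
  then have "(\<phi> \<circ> \<kappa>) w = \<kappa> w"
    using hom_eqI[of "\<phi> \<circ> \<kappa>" \<kappa> w] \<kappa> \<phi> w hom_one by auto
  then have \<phi>w: "\<phi> w = w" using w by simp
  have "\<phi> \<circ> \<phi> \<in> hom F F" "(\<lambda>u. u) \<in> hom F F" using \<phi> by (auto simp: hom_def Pi_iff)
  moreover have "(\<phi> \<circ> \<phi>) y = y" if "y \<in> gens" for y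
    using that \<phi> \<phi>x \<phi>w hom_mult[OF \<phi>(1) xC w(1)] mult_cancel[OF xC w(1)] by (cases "y = x") auto
  ultimately have \<phi>\<phi>: "\<phi> (\<phi> u) = u" if "u \<in> C" for u
    using hom_eqI[of "\<phi> \<circ> \<phi>" "\<lambda>u. u" u] that by simp
  have "bij_betw \<phi> C C"
    by (rule bij_betw_byWitness[where f' = \<phi>]) (use \<phi>\<phi> hom_closed[OF \<phi>(1)] in auto)
  then have \<phi>_auto: "restrict \<phi> C \<in> auto F"
    using \<phi>(1) by (auto simp: auto_def Bij_def hom_def Pi_iff)

  have "w \<noteq> x" using w \<kappa>(2)[OF T(1)] \<open>w \<noteq> e\<close> by auto
  have lenx: "len x = 1" using T(1) len_gen by simp
  then have "x \<noteq> e" by auto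
  have lenw: "len w > 0" using w(1) \<open>w \<noteq> e\<close> len_eq_0_iff[of w] by simp
  have xw: "x \<cdot> w \<in> C" using xC w by simp
  have "x \<cdot> w \<noteq> e" using mult_eq_one_iff[OF xC w(1)] \<open>w \<noteq> x\<close> by auto
  then have lenxw: "len (x \<cdot> w) > 0" using xw len_eq_0_iff[of "x \<cdot> w"] by simp
  \<comment> \<open>Deleting x does not lengthen, so w is no longer than xw and is not the top; x
    has length 1 and is not the top either. Hence xw is.\<close>
  have "\<kappa> (x \<cdot> w) = w" using hom_mult[OF \<kappa>(1) xC w(1)] \<kappa>(2)[OF T(1)] w by simp
  then have "len w \<le> len (x \<cdot> w)"
    using len_hom_le[OF \<kappa>(1) _ xw] \<kappa>(2) len_gen by auto
  then have "len (x \<cdot> w) = len x + len w"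
    using len_mult_cases[OF xC w(1) \<open>x \<noteq> e\<close> \<open>w \<noteq> e\<close>] \<open>w \<noteq> x\<close> lenx lenw lenxw by auto
  then have "len (restrict \<phi> C (x \<cdot> w)) = len (restrict \<phi> C x) + len (restrict \<phi> C w)"
    using preserves_topD[OF pres[OF \<phi>_auto] xC w(1)] w(3) by blast
  \<comment> \<open>As \<phi> exchanges x and xw, x would be the top, but 1 is not a sum of two
    positive lengths.\<close>
  then have "len x = len (x \<cdot> w) + len w"
    using xC w xw \<phi>w \<phi>x \<phi>\<phi>[OF xC] by simp
  then show False using lenx lenw lenxw by simp
qed

end

theorem theorem9:
  fixes X :: "'a set"
  assumes "finite X" and "card X > 3"
  shows "\<not> finitely_generated_group (AutoGroup (free_steiner_loop X))"
  using assms by (rule free_steiner.AutoGroup_not_finitely_generated)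

end
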